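(* Let $G$ be a group with a finite generating set $X$ and suppose that $(G,X)$ has the falsification by fellow traveler property (FFTP). Let $m>0$ be an integer and $Z=\{g\in G : |g|_X\le m\}$. Then $(G,Z)$ has FFTP. In particular, $G$ is FFTP-completable, i.e. every finite generating set of $G$ is contained in a finite generating set $X'$ of $G$ such that $(G,X')$ has FFTP.
   Context: $X\subseteq G$ is a generating set of $G$ if every element of $G$ is a product of elements of $X$ (generation as a monoid; $X$ need not be closed under inverses). $|g|_X$ is the minimal length of a word over $X$ representing $g$; $d_X(g,h)=|g^{-1}h|_X$. $\Gamma(G,X)$ is the Cayley graph, with an edge labelled $x$ from $g$ to $gx$. A path $p$ of length $n=\ell(p)$ follows edges through vertices $p(0),\dots,p(n)$, and $p(m)=p(n)$ for $m\ge n$; it is geodesic if no path with the same endpoints is shorter. Paths $p,q$ asynchronously $K$-fellow travel if there are non-decreasing $\phi,\psi:\mathbb N\to\mathbb N$ with $d_X(p(t),q(\phi(t)))\le K$ and $d_X(p(\psi(t)),q(t))\le K$ for all $t\in\mathbb N$. $(G,X)$ has FFTP if there is $K\ge0$ such that for every non-geodesic path $p$ in $\Gamma(G,X)$ there is a path $q$ with the same initial and terminal vertices, $\ell(q)<\ell(p)$, such that $p$ and $q$ asynchronously $K$-fellow travel. *)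

theory Defs
  imports "HOL-Algebra.Group" "Graph_Theory.Arc_Walk"
begin

definition word_val :: "('a, 'b) monoid_scheme \<Rightarrow> 'a list \<Rightarrow> 'a" where
  "word_val G xs = foldr (mult G) xs \<one>\<^bsub>G\<^esub>"

text \<open>Generation as a monoid: words use only letters of \<open>X\<close>, not their inverses.\<close>

definition generating_set :: "('a, 'b) monoid_scheme \<Rightarrow> 'a set \<Rightarrow> bool" where
  "generating_set G X \<longleftrightarrow>
     X \<subseteq> carrier G \<and> (\<forall>g\<in>carrier G. \<exists>xs\<in>lists X. word_val G xs = g)"

text \<open>Only meaningful if some word over \<open>X\<close> represents \<open>g\<close>.\<close>

definition word_length :: "('a, 'b) monoid_scheme \<Rightarrow> 'a set \<Rightarrow> 'a \<Rightarrow> nat" where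
  "word_length G X g = (LEAST n. \<exists>xs\<in>lists X. length xs = n \<and> word_val G xs = g)"

text \<open>Not symmetric in general, since \<open>X\<close> need not be closed under inverses.\<close>

definition word_dist :: "('a, 'b) monoid_scheme \<Rightarrow> 'a set \<Rightarrow> 'a \<Rightarrow> 'a \<Rightarrow> nat" where
  "word_dist G X g h = word_length G X (inv\<^bsub>G\<^esub> g \<otimes>\<^bsub>G\<^esub> h)"

text \<open>The arc \<open>(g, x)\<close> is the edge from \<open>g\<close> to \<open>g x\<close> with label \<open>x\<close>.\<close>

definition Cayley_graph ::
  "('a, 'b) monoid_scheme \<Rightarrow> 'a set \<Rightarrow> ('a, 'a \<times> 'a) pre_digraph" where
  "Cayley_graph G X =
     \<lparr> verts = carrier G, arcs = carrier G \<times> X,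
       tail = fst, head = (\<lambda>(g, x). g \<otimes>\<^bsub>G\<^esub> x) \<rparr>"

text \<open>
  A path is a directed walk in the Cayley graph, given by its initial vertex \<open>u\<close>,
  its list of arcs \<open>p\<close> and its terminal vertex \<open>v\<close>; its length is \<open>length p\<close>.
\<close>

abbreviation Cayley_path ::
  "('a, 'b) monoid_scheme \<Rightarrow> 'a set \<Rightarrow> 'a \<Rightarrow> ('a \<times> 'a) list \<Rightarrow> 'a \<Rightarrow> bool" where
  "Cayley_path G X u p v \<equiv> pre_digraph.awalk (Cayley_graph G X) u p v"

text \<open>The vertex at time \<open>t\<close>; after time \<open>length p\<close> the path rests at its terminal vertex.\<close>

definition path_vertex ::
  "('a, 'b) monoid_scheme \<Rightarrow> 'a set \<Rightarrow> 'a \<Rightarrow> ('a \<times> 'a) list \<Rightarrow> nat \<Rightarrow> 'a" where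
  "path_vertex G X u p t =
     pre_digraph.awalk_verts (Cayley_graph G X) u p ! min t (length p)"

definition geodesic ::
  "('a, 'b) monoid_scheme \<Rightarrow> 'a set \<Rightarrow> 'a \<Rightarrow> ('a \<times> 'a) list \<Rightarrow> 'a \<Rightarrow> bool" where
  "geodesic G X u p v \<longleftrightarrow>
     Cayley_path G X u p v \<and> \<not> (\<exists>q. Cayley_path G X u q v \<and> length q < length p)"

definition async_fellow_travel ::
  "('a, 'b) monoid_scheme \<Rightarrow> 'a set \<Rightarrow> nat \<Rightarrow> (nat \<Rightarrow> 'a) \<Rightarrow> (nat \<Rightarrow> 'a) \<Rightarrow> bool" where
  "async_fellow_travel G X K p q \<longleftrightarrow>
     (\<exists>\<phi> \<psi> :: nat \<Rightarrow> nat. mono \<phi> \<and> mono \<psi> \<and>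
        (\<forall>t. word_dist G X (p t) (q (\<phi> t)) \<le> K \<and> word_dist G X (p (\<psi> t)) (q t) \<le> K))"

definition FFTP :: "('a, 'b) monoid_scheme \<Rightarrow> 'a set \<Rightarrow> bool" where
  "FFTP G X \<longleftrightarrow>
     (\<exists>K. \<forall>u p v. Cayley_path G X u p v \<and> \<not> geodesic G X u p v \<longrightarrow>
        (\<exists>q. Cayley_path G X u q v \<and> length q < length p \<and>
             async_fellow_travel G X K (path_vertex G X u p) (path_vertex G X u q)))"

definition FFTP_completable :: "('a, 'b) monoid_scheme \<Rightarrow> bool" where
  "FFTP_completable G \<longleftrightarrow>
     (\<forall>Y. finite Y \<and> generating_set G Y \<longrightarrow>
        (\<exists>X'. Y \<subseteq> X' \<and> finite X' \<and> generating_set G X' \<and> FFTP G X'))"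

end

theory Submission
  imports Defs
begin

text \<open>
  Let \<open>Z\<close> be the ball of radius \<open>m\<close>. A path over \<open>Z\<close> can be refined to a path over \<open>X\<close> by
  writing each letter as a word of length at most \<open>m\<close>, and a path over \<open>X\<close> can be coarsened to a
  path over \<open>Z\<close> by recording only every \<open>m\<close>-th vertex. Both operations move a path by at most \<open>m\<close>
  (\<open>subdivision_fellow_travels\<close>, \<open>fellow_travels_regrouping\<close>), and coarsening divides the length
  by \<open>m\<close>, rounding up (\<open>regroup_word\<close>).

  Suppose that a path of length \<open>n + 1\<close> over \<open>Z\<close> is not geodesic. Its refinement has length at most
  \<open>m * n + m\<close>, while refining a shorter path over \<open>Z\<close> shows that some path over \<open>X\<close> with the same
  endpoints has length at most \<open>m * n\<close>. So as long as a path over \<open>X\<close> is longer than \<open>m * n\<close>, it is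
  not geodesic and FFTP over \<open>X\<close> shortens it; at most \<open>m\<close> applications bring the length down to
  \<open>m * n\<close> (\<open>word_FFTP_shorten\<close>). The coarsening of the result is a path over \<open>Z\<close> of length at
  most \<open>n\<close>. The fellow-traveller constants add up to \<open>m + m * K + m\<close> in \<open>d\<^sub>X\<close>, hence also in the
  smaller distance \<open>d\<^sub>Z\<close> (\<open>FFTP_ball\<close>).

  FFTP-completability follows since a finite set of elements lies in some ball, and balls are
  finite.

  Since \<open>d\<^sub>X\<close> is not symmetric, every estimate needs the right direction: distances are measured
  from the first path to the second, so a vertex of the first path has to be compared with one lying
  further along the route. This decides how times are rounded below.
\<close>

section \<open>Words and the word metric\<close>

context group
begin

lemma word_val_Nil [simp]: "word_val G [] = \<one>"
  by (simp add: word_val_def)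

lemma word_val_Cons [simp]: "word_val G (x # w) = x \<otimes> word_val G w"
  by (simp add: word_val_def)

lemma word_val_closed [simp, intro]:
  "w \<in> lists (carrier G) \<Longrightarrow> word_val G w \<in> carrier G"
  by (induction w) auto

lemma word_val_append:
  "v \<in> lists (carrier G) \<Longrightarrow> w \<in> lists (carrier G) \<Longrightarrow>
   word_val G (v @ w) = word_val G v \<otimes> word_val G w"
  by (induction v) (auto simp: m_assoc)

lemma word_length_le:
  "w \<in> lists X \<Longrightarrow> word_val G w = g \<Longrightarrow> word_length G X g \<le> length w"
  unfolding word_length_def by (rule Least_le) auto

lemma shortest_word:
  assumes "generating_set G X" "g \<in> carrier G"
  obtains w where "w \<in> lists X" "word_val G w = g" "length w = word_length G X g"
proof -
  have "\<exists>n. \<exists>w\<in>lists X. length w = n \<and> word_val G w = g"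
    using assms unfolding generating_set_def by blast
  then have "\<exists>w\<in>lists X. length w = word_length G X g \<and> word_val G w = g"
    unfolding word_length_def by (rule LeastI_ex)
  then show ?thesis using that by blast
qed

lemma word_length_mult_le:
  assumes gen: "generating_set G X" and g: "g \<in> carrier G" and h: "h \<in> carrier G"
  shows "word_length G X (g \<otimes> h) \<le> word_length G X g + word_length G X h"
proof -
  have X: "X \<subseteq> carrier G" using gen by (simp add: generating_set_def)
  obtain v where v: "v \<in> lists X" "word_val G v = g" "length v = word_length G X g"
    using shortest_word[OF gen g] .
  obtain w where w: "w \<in> lists X" "word_val G w = h" "length w = word_length G X h"
    using shortest_word[OF gen h] .
  have "word_val G (v @ w) = g \<otimes> h"
    using v w X lists_mono[OF X] by (subst word_val_append) auto
  then have "word_length G X (g \<otimes> h) \<le> length (v @ w)"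
    using v w by (intro word_length_le) auto
  then show ?thesis using v w by simp
qed

lemma word_dist_triangle:
  assumes gen: "generating_set G X" and "a \<in> carrier G" "b \<in> carrier G" "c \<in> carrier G"
  shows "word_dist G X a c \<le> word_dist G X a b + word_dist G X b c"
proof -
  have "b \<otimes> (inv b \<otimes> c) = c"
    using assms by (simp add: m_assoc[symmetric])
  then have "inv a \<otimes> c = (inv a \<otimes> b) \<otimes> (inv b \<otimes> c)"
    using assms by (simp add: m_assoc)
  then show ?thesis
    unfolding word_dist_def using word_length_mult_le[OF gen] assms by simp
qed

lemma word_dist_translate:
  assumes "u \<in> carrier G" "a \<in> carrier G" "b \<in> carrier G"
  shows "word_dist G X (u \<otimes> a) (u \<otimes> b) = word_dist G X a b"
proof -
  have "inv u \<otimes> (u \<otimes> b) = b"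
    using assms by (simp add: m_assoc[symmetric])
  then have "inv (u \<otimes> a) \<otimes> (u \<otimes> b) = inv a \<otimes> b"
    using assms by (simp add: inv_mult_group m_assoc)
  then show ?thesis by (simp add: word_dist_def)
qed

text \<open>Enlarging the generating set shortens distances; this takes fellow travelling from \<open>X\<close> to a ball.\<close>

lemma word_dist_antimono:
  assumes gen: "generating_set G X" and sub: "X \<subseteq> Z"
    and "a \<in> carrier G" "b \<in> carrier G"
  shows "word_dist G Z a b \<le> word_dist G X a b"
proof -
  obtain w where "w \<in> lists X" "word_val G w = inv a \<otimes> b"
    "length w = word_length G X (inv a \<otimes> b)"
    using shortest_word[OF gen, of "inv a \<otimes> b"] assms by auto
  then show ?thesis
    unfolding word_dist_def using word_length_le[of w Z] lists_mono[OF sub] by auto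
qed

text \<open>The forward distance only: nothing bounds the distance back along the word in these terms.\<close>

lemma word_dist_prefixes_le:
  assumes X: "X \<subseteq> carrier G" and w: "w \<in> lists X" and st: "s \<le> t"
  shows "word_dist G X (word_val G (take s w)) (word_val G (take t w)) \<le> t - s"
proof -
  let ?v = "take (t - s) (drop s w)"
  have "set w \<subseteq> X" using w by auto
  then have v: "?v \<in> lists X" and p: "take s w \<in> lists X"
    by (auto dest: in_set_takeD in_set_dropD)
  then have c: "?v \<in> lists (carrier G)" "take s w \<in> lists (carrier G)"
    using lists_mono[OF X] by auto
  have "take t w = take s w @ ?v"
    using st by (metis le_add_diff_inverse take_add)
  then have "inv (word_val G (take s w)) \<otimes> word_val G (take t w) = word_val G ?v"
    using word_val_append[OF c(2) c(1)] word_val_closed[OF c(1)] word_val_closed[OF c(2)]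
    by (simp add: m_assoc[symmetric])
  then have "word_dist G X (word_val G (take s w)) (word_val G (take t w)) \<le> length ?v"
    unfolding word_dist_def using word_length_le[OF v] by simp
  then show ?thesis by simp
qed

section \<open>Asynchronous fellow travelling\<close>

lemma async_fellow_travel_refl:
  assumes "range p \<subseteq> carrier G"
  shows "async_fellow_travel G X 0 p p"
proof -
  have "word_length G X \<one> = 0" using word_length_le[of "[]" X \<one>] by simp
  then have "word_dist G X (p t) (p t) = 0" for t
    using assms by (simp add: word_dist_def l_inv range_subsetD)
  then show ?thesis
    unfolding async_fellow_travel_def by (auto intro!: exI[of _ "\<lambda>t. t"] simp: mono_def)
qed

lemma async_fellow_travel_trans:
  assumes gen: "generating_set G X"
    and "range p \<subseteq> carrier G" "range q \<subseteq> carrier G" "range r \<subseteq> carrier G"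
    and "async_fellow_travel G X K p q" "async_fellow_travel G X L q r"
  shows "async_fellow_travel G X (K + L) p r"
proof -
  have in_G: "p t \<in> carrier G" "q t \<in> carrier G" "r t \<in> carrier G" for t
    using assms by auto
  obtain f f' where f: "mono f" "mono f'"
    "\<And>t. word_dist G X (p t) (q (f t)) \<le> K" "\<And>t. word_dist G X (p (f' t)) (q t) \<le> K"
    using assms(5) unfolding async_fellow_travel_def by blast
  obtain g g' where g: "mono g" "mono g'"
    "\<And>t. word_dist G X (q t) (r (g t)) \<le> L" "\<And>t. word_dist G X (q (g' t)) (r t) \<le> L"
    using assms(6) unfolding async_fellow_travel_def by blast
  have "word_dist G X (p t) (r ((g \<circ> f) t)) \<le> K + L" for t
    using word_dist_triangle[OF gen in_G(1)[of t] in_G(2)[of "f t"] in_G(3)[of "g (f t)"]]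
      f(3)[of t] g(3)[of "f t"] by simp
  moreover have "word_dist G X (p ((f' \<circ> g') t)) (r t) \<le> K + L" for t
    using word_dist_triangle[OF gen in_G(1)[of "f' (g' t)"] in_G(2)[of "g' t"] in_G(3)[of t]]
      f(4)[of "g' t"] g(4)[of t] by simp
  moreover have "mono (g \<circ> f)" "mono (f' \<circ> g')"
    using f g by (simp_all add: mono_def)
  ultimately show ?thesis
    unfolding async_fellow_travel_def by blast
qed

lemma async_fellow_travel_antimono:
  assumes "generating_set G X" "X \<subseteq> Z" "range p \<subseteq> carrier G" "range q \<subseteq> carrier G"
    and "async_fellow_travel G X K p q"
  shows "async_fellow_travel G Z K p q"
proof -
  have "word_dist G Z (p s) (q t) \<le> K" if "word_dist G X (p s) (q t) \<le> K" for s t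
    using word_dist_antimono[OF assms(1,2), of "p s" "q t"] assms(3,4) that
    by (meson le_trans range_subsetD)
  then show ?thesis
    using assms(5) unfolding async_fellow_travel_def by blast
qed

lemma async_fellow_travel_translate:
  assumes "u \<in> carrier G" "range p \<subseteq> carrier G" "range q \<subseteq> carrier G"
  shows "async_fellow_travel G X K (\<lambda>t. u \<otimes> p t) (\<lambda>t. u \<otimes> q t) \<longleftrightarrow>
         async_fellow_travel G X K p q"
proof -
  have "word_dist G X (u \<otimes> p s) (u \<otimes> q t) = word_dist G X (p s) (q t)" for s t
    using assms by (intro word_dist_translate) auto
  then show ?thesis unfolding async_fellow_travel_def by simp
qed

section \<open>Paths as words\<close>

lemma Cayley_path_Nil_iff:
  "Cayley_path G X u [] v \<longleftrightarrow> u \<in> carrier G \<and> v = u"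
  by (auto simp: pre_digraph.awalk_def pre_digraph.cas.simps Cayley_graph_def)

lemma Cayley_path_Cons_iff:
  assumes "X \<subseteq> carrier G"
  shows "Cayley_path G X u (a # p) v \<longleftrightarrow>
    u \<in> carrier G \<and> fst a = u \<and> snd a \<in> X \<and> Cayley_path G X (u \<otimes> snd a) p v"
  using assms
  by (cases a) (auto simp: pre_digraph.awalk_def pre_digraph.cas.simps Cayley_graph_def)

text \<open>
  A path in the Cayley graph is determined by its initial vertex and its label. This lemma reads off
  the label of a path; its converse \<open>Cayley_path_of_word\<close> traces a word from a given vertex.
\<close>

lemma Cayley_path_word:
  assumes X: "X \<subseteq> carrier G" and "Cayley_path G X u p v"
  shows "u \<in> carrier G" "map snd p \<in> lists X" "v = u \<otimes> word_val G (map snd p)"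
    "path_vertex G X u p = (\<lambda>t. u \<otimes> word_val G (take t (map snd p)))"
proof -
  have "u \<in> carrier G \<and> map snd p \<in> lists X \<and> v = u \<otimes> word_val G (map snd p) \<and>
    (\<forall>t. path_vertex G X u p t = u \<otimes> word_val G (take t (map snd p)))"
    using assms(2)
  proof (induction p arbitrary: u)
    case Nil
    then show ?case
      by (auto simp: Cayley_path_Nil_iff path_vertex_def pre_digraph.awalk_verts.simps)
  next
    case (Cons a p)
    then have a: "u \<in> carrier G" "fst a = u" "snd a \<in> X"
      and p: "Cayley_path G X (u \<otimes> snd a) p v"
      by (auto simp: Cayley_path_Cons_iff[OF X])
    note IH = Cons.IH[OF p]
    have c: "map snd p \<in> lists (carrier G)" using IH lists_mono[OF X] by auto
    have tc: "take t (map snd p) \<in> lists (carrier G)" for t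
      using c by (auto dest: in_set_takeD)
    have "path_vertex G X u (a # p) t = u \<otimes> word_val G (take t (map snd (a # p)))" for t
    proof (cases t)
      case 0
      then show ?thesis using a
        by (simp add: path_vertex_def pre_digraph.awalk_verts.simps Cayley_graph_def)
    next
      case (Suc s)
      have "path_vertex G X u (a # p) t = path_vertex G X (u \<otimes> snd a) p s"
        using Suc a(2) by (cases a)
          (simp add: path_vertex_def pre_digraph.awalk_verts.simps Cayley_graph_def)
      also have "\<dots> = (u \<otimes> snd a) \<otimes> word_val G (take s (map snd p))"
        using IH by simp
      finally show ?thesis
        using Suc a X word_val_closed[OF tc[of s]] by (auto simp: m_assoc)
    qed
    then show ?case
      using IH a X word_val_closed[OF c] by (auto simp: m_assoc)
  qed
  then show "u \<in> carrier G" "map snd p \<in> lists X" "v = u \<otimes> word_val G (map snd p)"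
    "path_vertex G X u p = (\<lambda>t. u \<otimes> word_val G (take t (map snd p)))"
    by auto
qed

lemma Cayley_path_of_word:
  assumes X: "X \<subseteq> carrier G" and "u \<in> carrier G" "w \<in> lists X"
  obtains p where "Cayley_path G X u p (u \<otimes> word_val G w)" "map snd p = w"
proof -
  have "\<exists>p. Cayley_path G X u p (u \<otimes> word_val G w) \<and> map snd p = w"
    using assms(2,3)
  proof (induction w arbitrary: u)
    case Nil
    then show ?case by (auto simp: Cayley_path_Nil_iff)
  next
    case (Cons x w)
    have "x \<in> carrier G" "w \<in> lists (carrier G)"
      using Cons.prems X lists_mono[OF X] by auto
    then have *: "u \<otimes> word_val G (x # w) = (u \<otimes> x) \<otimes> word_val G w"
      using Cons.prems word_val_closed[of w] by (simp add: m_assoc)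
    obtain p where p: "Cayley_path G X (u \<otimes> x) p ((u \<otimes> x) \<otimes> word_val G w)" "map snd p = w"
      using Cons.IH[of "u \<otimes> x"] Cons.prems \<open>x \<in> carrier G\<close> by auto
    have "Cayley_path G X u ((u, x) # p) (u \<otimes> word_val G (x # w))"
      unfolding * Cayley_path_Cons_iff[OF X] using p Cons.prems by simp
    then show ?case using p(2) by (intro exI[of _ "(u, x) # p"]) simp
  qed
  then show ?thesis using that by blast
qed

definition prefix_val :: "'a list \<Rightarrow> nat \<Rightarrow> 'a" where
  "prefix_val w t = word_val G (take t w)"

lemma prefix_val_range: "w \<in> lists (carrier G) \<Longrightarrow> range (prefix_val w) \<subseteq> carrier G"
  by (auto simp: prefix_val_def dest: in_set_takeD intro!: word_val_closed)

text \<open>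
  FFTP for words, that is, for the paths that start at the identity, with explicit constant. It
  suffices to look at these paths because left multiplication acts on the Cayley graph by isometries.
\<close>

definition word_FFTP :: "'a set \<Rightarrow> nat \<Rightarrow> bool" where
  "word_FFTP X K \<longleftrightarrow>
     (\<forall>w\<in>lists X. \<forall>w'\<in>lists X. word_val G w' = word_val G w \<and> length w' < length w \<longrightarrow>
        (\<exists>v\<in>lists X. word_val G v = word_val G w \<and> length v < length w \<and>
             async_fellow_travel G X K (prefix_val w) (prefix_val v)))"

lemma FFTP_iff_word_FFTP:
  assumes X: "X \<subseteq> carrier G"
  shows "FFTP G X \<longleftrightarrow> (\<exists>K. word_FFTP X K)"
proof
  assume "FFTP G X"
  then obtain K where K: "\<And>u p v. Cayley_path G X u p v \<Longrightarrow> \<not> geodesic G X u p v \<Longrightarrow>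
        \<exists>q. Cayley_path G X u q v \<and> length q < length p \<and>
             async_fellow_travel G X K (path_vertex G X u p) (path_vertex G X u q)"
    unfolding FFTP_def by blast
  have "word_FFTP X K"
    unfolding word_FFTP_def
  proof (intro ballI impI, elim conjE)
    fix w w' assume w: "w \<in> lists X" "w' \<in> lists X"
      and eq: "word_val G w' = word_val G w" and less: "length w' < length w"
    obtain p where p: "Cayley_path G X \<one> p (\<one> \<otimes> word_val G w)" "map snd p = w"
      using Cayley_path_of_word[OF X one_closed w(1)] .
    obtain p' where p': "Cayley_path G X \<one> p' (\<one> \<otimes> word_val G w')" "map snd p' = w'"
      using Cayley_path_of_word[OF X one_closed w(2)] .
    have "length p' < length p" using less p(2) p'(2) by auto
    then have "\<not> geodesic G X \<one> p (\<one> \<otimes> word_val G w)"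
      using p'(1) eq unfolding geodesic_def by auto
    then obtain q where q: "Cayley_path G X \<one> q (\<one> \<otimes> word_val G w)" "length q < length p"
      "async_fellow_travel G X K (path_vertex G X \<one> p) (path_vertex G X \<one> q)"
      using K[OF p(1)] by blast
    note P = Cayley_path_word[OF X p(1)] and Q = Cayley_path_word[OF X q(1)]
    have c: "w \<in> lists (carrier G)" "map snd q \<in> lists (carrier G)"
      using w Q(2) lists_mono[OF X] by auto
    have "async_fellow_travel G X K (prefix_val w) (prefix_val (map snd q))"
      using q(3) async_fellow_travel_translate[OF one_closed
          prefix_val_range[OF c(1)] prefix_val_range[OF c(2)]]
      unfolding P(4) Q(4) p(2) prefix_val_def by blast
    moreover have "word_val G (map snd q) = word_val G w"
      using Q(3) word_val_closed[OF c(1)] word_val_closed[OF c(2)] by simp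
    moreover have "length (map snd q) < length w" using q(2) p(2) by auto
    ultimately show "\<exists>v\<in>lists X. word_val G v = word_val G w \<and> length v < length w \<and>
             async_fellow_travel G X K (prefix_val w) (prefix_val v)"
      using Q(2) by blast
  qed
  then show "\<exists>K. word_FFTP X K" ..
next
  assume "\<exists>K. word_FFTP X K"
  then obtain K where K: "word_FFTP X K" ..
  have "\<exists>q. Cayley_path G X u q v \<and> length q < length p \<and>
             async_fellow_travel G X K (path_vertex G X u p) (path_vertex G X u q)"
    if p: "Cayley_path G X u p v" and not_geo: "\<not> geodesic G X u p v" for u p v
  proof -
    obtain p' where p': "Cayley_path G X u p' v" "length p' < length p"
      using p not_geo unfolding geodesic_def by blast
    note P = Cayley_path_word[OF X p] and P' = Cayley_path_word[OF X p'(1)]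
    have c: "map snd p \<in> lists (carrier G)" "map snd p' \<in> lists (carrier G)"
      using P(2) P'(2) lists_mono[OF X] by auto
    have "word_val G (map snd p') = word_val G (map snd p)"
      using P(1,3) P'(3) word_val_closed[OF c(1)] word_val_closed[OF c(2)] by simp
    then obtain w where w: "w \<in> lists X" "word_val G w = word_val G (map snd p)"
      "length w < length p"
      "async_fellow_travel G X K (prefix_val (map snd p)) (prefix_val w)"
      using K P(2) P'(2) p'(2) unfolding word_FFTP_def by (metis length_map)
    obtain q where q: "Cayley_path G X u q (u \<otimes> word_val G w)" "map snd q = w"
      using Cayley_path_of_word[OF X P(1) w(1)] .
    have cw: "w \<in> lists (carrier G)" using w(1) lists_mono[OF X] by auto
    have "path_vertex G X u p = (\<lambda>t. u \<otimes> prefix_val (map snd p) t)"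
      "path_vertex G X u q = (\<lambda>t. u \<otimes> prefix_val w t)"
      using P(4) Cayley_path_word(4)[OF X q(1)] q(2) by (auto simp: prefix_val_def)
    then have "async_fellow_travel G X K (path_vertex G X u p) (path_vertex G X u q)"
      using w(4) async_fellow_travel_translate[OF P(1)
          prefix_val_range[OF c(1)] prefix_val_range[OF cw]] by simp
    moreover have "length q < length p" using w(3) q(2) by auto
    ultimately show ?thesis using q(1) w(2) P(3) by auto
  qed
  then show "FFTP G X" unfolding FFTP_def by blast
qed

section \<open>Shortening, subdividing and regrouping words\<close>

text \<open>
  Each application of FFTP saves at least one letter, and it applies while the word is longer than
  \<open>l\<close>, for then \<open>v0\<close> witnesses that the word is not geodesic. An excess of \<open>j\<close> letters thus costs at
  most \<open>j\<close> applications.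
\<close>

lemma word_FFTP_shorten:
  assumes gen: "generating_set G X" and K: "word_FFTP X K"
    and "v0 \<in> lists X" "length v0 \<le> l"
    and "w \<in> lists X" "word_val G w = word_val G v0" "length w \<le> l + j"
  shows "\<exists>v\<in>lists X. word_val G v = word_val G v0 \<and> length v \<le> l \<and>
           async_fellow_travel G X (j * K) (prefix_val w) (prefix_val v)"
  using assms(5-7)
proof (induction j arbitrary: w)
  case 0
  have "w \<in> lists (carrier G)"
    using 0 gen lists_mono unfolding generating_set_def by blast
  then show ?case
    using 0 async_fellow_travel_refl[OF prefix_val_range] by auto
next
  case (Suc j)
  have X: "lists X \<subseteq> lists (carrier G)"
    using gen lists_mono unfolding generating_set_def by blast
  obtain w' where w': "w' \<in> lists X" "word_val G w' = word_val G v0" "length w' \<le> l + j"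
    and ww': "async_fellow_travel G X K (prefix_val w) (prefix_val w')"
  proof (cases "length w \<le> l")
    case True
    have "async_fellow_travel G X 0 (prefix_val w) (prefix_val w)"
      using Suc.prems X by (intro async_fellow_travel_refl prefix_val_range) auto
    then have "async_fellow_travel G X K (prefix_val w) (prefix_val w)"
      unfolding async_fellow_travel_def by (meson le0 le_trans)
    then show ?thesis using that[of w] Suc.prems True by simp
  next
    case False
    then have "word_val G v0 = word_val G w \<and> length v0 < length w"
      using Suc.prems(2) assms(4) by simp
    then obtain w' where "w' \<in> lists X" "word_val G w' = word_val G w" "length w' < length w"
      "async_fellow_travel G X K (prefix_val w) (prefix_val w')"
      using K Suc.prems(1) assms(3) unfolding word_FFTP_def by blast
    then show ?thesis using that[of w'] Suc.prems by simp
  qed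
  obtain v where v: "v \<in> lists X" "word_val G v = word_val G v0" "length v \<le> l"
    "async_fellow_travel G X (j * K) (prefix_val w') (prefix_val v)"
    using Suc.IH[OF w'] by blast
  have "async_fellow_travel G X (K + j * K) (prefix_val w) (prefix_val v)"
    using async_fellow_travel_trans[OF gen _ _ _ ww' v(4)] Suc.prems(1) w'(1) v(1) X
    by (meson prefix_val_range subsetD)
  then show ?case using v by auto
qed

lemma word_val_concat_map:
  assumes "\<And>z. z \<in> set w \<Longrightarrow> U z \<in> lists (carrier G) \<and> word_val G (U z) = z"
  shows "word_val G (concat (map U w)) = word_val G w"
  using assms
proof (induction w)
  case (Cons z w)
  have "concat (map U w) \<in> lists (carrier G)" using Cons.prems by fastforce
  then show ?case using Cons by (simp add: word_val_append)
qed simp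

text \<open>
  The path \<open>w\<close> visits the subdivided path at the times \<open>a t\<close>, so vertices of \<open>w\<close> are matched exactly.
  Conversely a vertex of the subdivided path is matched with the last vertex of \<open>w\<close> at or before it:
  rounding down, as \<open>w\<close> is the first path.
\<close>

lemma subdivision_fellow_travels:
  assumes X: "X \<subseteq> carrier G"
    and U: "\<And>z. z \<in> set w \<Longrightarrow> U z \<in> lists X \<and> word_val G (U z) = z \<and> length (U z) \<le> m"
  shows "async_fellow_travel G X m (prefix_val w) (prefix_val (concat (map U w)))"
proof -
  define e where "e = concat (map U w)"
  define a where "a t = length (concat (map U (take t w)))" for t
  have e: "e \<in> lists X" using U unfolding e_def by fastforce
  have U': "U z \<in> lists (carrier G) \<and> word_val G (U z) = z" if "z \<in> set w" for z
    using U[OF that] lists_mono[OF X] by auto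
  have sample: "prefix_val w t = prefix_val e (a t)" for t
  proof -
    have "e = concat (map U (take t w)) @ concat (map U (drop t w))"
      by (metis e_def append_take_drop_id concat_append map_append)
    then have "take (a t) e = concat (map U (take t w))" by (simp add: a_def)
    moreover have "word_val G (concat (map U (take t w))) = word_val G (take t w)"
      by (rule word_val_concat_map) (use U' in_set_takeD in fast)
    ultimately show ?thesis by (simp add: prefix_val_def)
  qed
  have a_Suc: "a t \<le> a (Suc t) \<and> a (Suc t) \<le> a t + m" for t
    using U by (cases "t < length w") (auto simp: a_def take_Suc_conv_app_nth)
  have mono_a: "mono a" using a_Suc by (simp add: mono_iff_le_Suc)
  have a0: "a 0 = 0" and a_end: "a (length w) = length e" by (simp_all add: a_def e_def)
  \<comment> \<open>The bound on \<open>i\<close> keeps the set finite: \<open>a\<close> is constant from \<open>length w\<close> on.\<close>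
  define I where "I s = {i. i \<le> length w \<and> a i \<le> s}" for s
  have I: "finite (I s)" "I s \<noteq> {}" for s
    using a0 unfolding I_def by (auto intro: exI[of _ 0])
  have "mono (\<lambda>s. Max (I s))"
    using I by (intro monoI Max_mono) (auto simp: I_def)
  moreover have "word_dist G X (prefix_val w (Max (I s))) (prefix_val e s) \<le> m" for s
  proof -
    let ?i = "Max (I s)"
    have i: "?i \<le> length w" "a ?i \<le> s" using Max_in[OF I, of s] by (auto simp: I_def)
    show ?thesis
    proof (cases "?i = length w")
      case True
      then have "prefix_val e s = prefix_val e (a ?i)"
        using i(2) a_end by (simp add: prefix_val_def)
      then show ?thesis
        using word_dist_prefixes_le[OF X e, of "a ?i" "a ?i"] sample by (simp add: prefix_val_def)
    next
      case False
      have "Suc ?i \<notin> I s" using Max_ge[OF I(1), of "Suc ?i" s] by auto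
      then have "s < a (Suc ?i)" using False i by (auto simp: I_def)
      then have "s - a ?i \<le> m" using a_Suc[of ?i] by linarith
      then show ?thesis
        using word_dist_prefixes_le[OF X e i(2)]
        by (simp only: sample) (simp add: prefix_val_def)
    qed
  qed
  moreover have "word_dist G X (prefix_val w t) (prefix_val e (a t)) \<le> m" for t
    using word_dist_prefixes_le[OF X e, of "a t" "a t"] sample by (simp add: prefix_val_def)
  ultimately show ?thesis
    unfolding async_fellow_travel_def e_def[symmetric] using mono_a by blast
qed

text \<open>
  Cut \<open>v\<close> into blocks of \<open>m\<close> letters, the last of which may be shorter, and let the value of each
  block be one letter.
\<close>

lemma regroup_word:
  assumes X: "X \<subseteq> carrier G" and "v \<in> lists X" "length v \<le> m * k"
  shows "\<exists>q\<in>lists {g \<in> carrier G. word_length G X g \<le> m}. length q \<le> k \<and>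
           (\<forall>t. prefix_val q t = prefix_val v (m * t))"
  using assms(2,3)
proof (induction k arbitrary: v)
  case 0
  then show ?case by (auto simp: prefix_val_def intro!: bexI[of _ "[]"])
next
  case (Suc k)
  let ?Z = "{g \<in> carrier G. word_length G X g \<le> m}"
  have sub: "take i v \<in> lists X" "drop i v \<in> lists X" for i
    using Suc.prems(1) by (auto dest: in_set_takeD in_set_dropD)
  obtain q where q: "q \<in> lists ?Z" "length q \<le> k"
    "\<And>t. prefix_val q t = prefix_val (drop m v) (m * t)"
  proof -
    have "length (drop m v) \<le> m * k" using Suc.prems(2) by simp
    then show ?thesis using Suc.IH[OF sub(2)] that by blast
  qed
  let ?q = "word_val G (take m v) # q"
  have c: "take m v \<in> lists (carrier G)" using sub lists_mono[OF X] by blast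
  have cd: "take i (drop m v) \<in> lists (carrier G)" for i
    using sub(2)[of m] lists_mono[OF X] by (auto dest: in_set_takeD)
  have "word_val G (take m v) \<in> ?Z"
    using word_val_closed[OF c] word_length_le[OF sub(1) refl, of m] by auto
  moreover have "prefix_val ?q t = prefix_val v (m * t)" for t
  proof (cases t)
    case (Suc s)
    have "prefix_val ?q t = word_val G (take m v) \<otimes> prefix_val (drop m v) (m * s)"
      using q(3)[of s] Suc by (simp add: prefix_val_def)
    also have "\<dots> = word_val G (take (m + m * s) v)"
      unfolding prefix_val_def take_add by (rule word_val_append[OF c cd, symmetric])
    finally show ?thesis using Suc by (simp add: prefix_val_def)
  qed (simp add: prefix_val_def)
  ultimately show ?case using q by (intro bexI[of _ ?q]) auto
qed

text \<open>
  Here the finer path \<open>v\<close> comes first, so a vertex of \<open>v\<close> is matched with the next vertex of \<open>q\<close>: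
  \<open>r s\<close> is \<open>s / m\<close> rounded up.
\<close>

lemma fellow_travels_regrouping:
  assumes X: "X \<subseteq> carrier G" and v: "v \<in> lists X" and m: "m > 0"
    and q: "\<And>t. prefix_val q t = prefix_val v (m * t)"
  shows "async_fellow_travel G X m (prefix_val v) (prefix_val q)"
proof -
  define r where "r s = (s + m - 1) div m" for s
  have r: "s \<le> m * r s" "m * r s \<le> s + m" for s
  proof -
    have "m * r s + (s + m - 1) mod m = s + m - 1" unfolding r_def by simp
    moreover have "(s + m - 1) mod m < m" using m by simp
    ultimately show "s \<le> m * r s" "m * r s \<le> s + m" using m by linarith+
  qed
  have "word_dist G X (prefix_val v s) (prefix_val q (r s)) \<le> m" for s
    using word_dist_prefixes_le[OF X v r(1)[of s]] r(2)[of s] unfolding q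
    by (simp add: prefix_val_def)
  moreover have "word_dist G X (prefix_val v (m * t)) (prefix_val q t) \<le> m" for t
    using word_dist_prefixes_le[OF X v, of "m * t" "m * t"] unfolding q
    by (simp add: prefix_val_def)
  moreover have "mono r" unfolding r_def by (intro monoI div_le_mono) simp
  moreover have "mono (\<lambda>t. m * t)" by (simp add: mono_def)
  ultimately show ?thesis unfolding async_fellow_travel_def by blast
qed

section \<open>Balls as generating sets\<close>

lemma subset_ball:
  assumes "X \<subseteq> carrier G" "m > 0"
  shows "X \<subseteq> {g \<in> carrier G. word_length G X g \<le> m}"
proof
  fix x assume "x \<in> X"
  then show "x \<in> {g \<in> carrier G. word_length G X g \<le> m}"
    using assms word_length_le[of "[x]" X x] by (auto simp: subset_iff)
qed

lemma FFTP_ball: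
  assumes gen: "generating_set G X" and FFTP: "FFTP G X" and m: "m > 0"
  shows "FFTP G {g \<in> carrier G. word_length G X g \<le> m}" (is "FFTP G ?Z")
proof -
  have X: "X \<subseteq> carrier G" using gen by (simp add: generating_set_def)
  note XG = lists_mono[OF X]
  have Z: "?Z \<subseteq> carrier G" by blast
  obtain K where K: "word_FFTP X K" using FFTP FFTP_iff_word_FFTP[OF X] by blast
  have "\<exists>u. u \<in> lists X \<and> word_val G u = z \<and> length u \<le> m" if "z \<in> ?Z" for z
    using shortest_word[OF gen, of z] that by (metis (lifting) mem_Collect_eq)
  then obtain U where U: "\<And>z. z \<in> ?Z \<Longrightarrow>
      U z \<in> lists X \<and> word_val G (U z) = z \<and> length (U z) \<le> m"
    by metis
  define E where "E w = concat (map U w)" for w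
  have E: "E w \<in> lists X" "word_val G (E w) = word_val G w" "length (E w) \<le> m * length w"
    if w: "w \<in> lists ?Z" for w
  proof -
    have Uw: "U z \<in> lists X \<and> word_val G (U z) = z \<and> length (U z) \<le> m" if "z \<in> set w" for z
      using U w that by blast
    then show "E w \<in> lists X" unfolding E_def by fastforce
    show "word_val G (E w) = word_val G w"
      unfolding E_def using Uw XG by (intro word_val_concat_map) blast
    show "length (E w) \<le> m * length w"
      using Uw unfolding E_def by (induction w) (auto intro: add_mono)
  qed
  have "word_FFTP ?Z (m + m * K + m)"
    unfolding word_FFTP_def
  proof (intro ballI impI, elim conjE)
    fix w w' assume w: "w \<in> lists ?Z" and w': "w' \<in> lists ?Z"
      and eq: "word_val G w' = word_val G w" and less: "length w' < length w"
    obtain n where n: "length w = Suc n" "length w' \<le> n" using less by (cases "length w") auto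
    have "length (E w') \<le> m * n" using E(3)[OF w'] n(2) by (meson le_trans mult_le_mono2)
    moreover have "length (E w) \<le> m * n + m" using E(3)[OF w] n(1) by simp
    ultimately obtain v where v: "v \<in> lists X" "word_val G v = word_val G (E w')"
      "length v \<le> m * n"
      "async_fellow_travel G X (m * K) (prefix_val (E w)) (prefix_val v)"
      using word_FFTP_shorten[OF gen K E(1)[OF w'] _ E(1)[OF w], of "m * n" m]
        E(2)[OF w] E(2)[OF w'] eq by auto
    obtain q where q: "q \<in> lists ?Z" "length q \<le> n"
      "\<And>t. prefix_val q t = prefix_val v (m * t)"
      using regroup_word[OF X v(1,3)] by blast
    \<comment> \<open>At a time when both paths have ended, agreement of the vertices is agreement of the endpoints.\<close>
    have "prefix_val q (length q + length v) = prefix_val v (m * (length q + length v))"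
      by (rule q(3))
    moreover have "length v \<le> m * (length q + length v)" using m by (cases m) auto
    ultimately have val_q: "word_val G q = word_val G v"
      by (simp add: prefix_val_def)
    have wE: "async_fellow_travel G X m (prefix_val w) (prefix_val (E w))"
      unfolding E_def by (rule subdivision_fellow_travels[OF X]) (use U w in blast)
    have "w \<in> lists (carrier G)" "q \<in> lists (carrier G)"
      using w q(1) lists_mono[OF Z] by auto
    then have r: "range (prefix_val w) \<subseteq> carrier G" "range (prefix_val q) \<subseteq> carrier G"
      "range (prefix_val (E w)) \<subseteq> carrier G" "range (prefix_val v) \<subseteq> carrier G"
      using E(1)[OF w] v(1) XG by (auto intro!: prefix_val_range)
    have "async_fellow_travel G X (m + m * K) (prefix_val w) (prefix_val v)"
      by (rule async_fellow_travel_trans[OF gen r(1,3,4) wE v(4)])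
    then have "async_fellow_travel G X (m + m * K + m) (prefix_val w) (prefix_val q)"
      by (rule async_fellow_travel_trans[OF gen r(1,4,2)])
        (rule fellow_travels_regrouping[OF X v(1) m q(3)])
    then have "async_fellow_travel G ?Z (m + m * K + m) (prefix_val w) (prefix_val q)"
      by (rule async_fellow_travel_antimono[OF gen subset_ball[OF X m] r(1,2)])
    moreover have "word_val G q = word_val G w" "length q < length w"
      using val_q v(2) E(2)[OF w'] eq q(2) n(1) by auto
    ultimately show "\<exists>v\<in>lists ?Z. word_val G v = word_val G w \<and> length v < length w \<and>
        async_fellow_travel G ?Z (m + m * K + m) (prefix_val w) (prefix_val v)"
      using q(1) by blast
  qed
  then show ?thesis using FFTP_iff_word_FFTP[OF Z] by blast
qed

lemma finite_ball:
  assumes gen: "generating_set G X" and "finite X"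
  shows "finite {g \<in> carrier G. word_length G X g \<le> m}"
proof (rule finite_subset)
  show "finite (word_val G ` {w. set w \<subseteq> X \<and> length w \<le> m})"
    by (intro finite_imageI finite_lists_length_le \<open>finite X\<close>)
  show "{g \<in> carrier G. word_length G X g \<le> m}
      \<subseteq> word_val G ` {w. set w \<subseteq> X \<and> length w \<le> m}"
  proof
    fix g assume g: "g \<in> {g \<in> carrier G. word_length G X g \<le> m}"
    then have "g \<in> carrier G" by simp
    then obtain w where "w \<in> lists X" "word_val G w = g" "length w = word_length G X g"
      by (rule shortest_word[OF gen])
    then show "g \<in> word_val G ` {w. set w \<subseteq> X \<and> length w \<le> m}"
      using g by (intro image_eqI[of _ _ w]) auto
  qed
qed

lemma generating_set_mono:
  assumes "generating_set G X" "X \<subseteq> Z" "Z \<subseteq> carrier G"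
  shows "generating_set G Z"
  using assms lists_mono[OF assms(2)] unfolding generating_set_def by (meson subsetD)

lemma FFTP_completable_of_FFTP:
  assumes gen: "generating_set G X" and "finite X" and FFTP: "FFTP G X"
  shows "FFTP_completable G"
  unfolding FFTP_completable_def
proof (intro allI impI, elim conjE)
  fix Y assume Y: "finite Y" "generating_set G Y"
  \<comment> \<open>The \<open>0\<close> covers empty \<open>Y\<close>, and the successor makes the radius positive.\<close>
  define m where "m = Suc (Max (insert 0 (word_length G X ` Y)))"
  let ?Z = "{g \<in> carrier G. word_length G X g \<le> m}"
  have "word_length G X y \<le> m" if "y \<in> Y" for y
    using that Y(1) unfolding m_def by (intro le_SucI Max_ge) auto
  then have "Y \<subseteq> ?Z" using Y(2) unfolding generating_set_def by blast
  moreover have "generating_set G ?Z"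
    using generating_set_mono[OF Y(2) \<open>Y \<subseteq> ?Z\<close>] by blast
  moreover have "finite ?Z" using finite_ball[OF gen \<open>finite X\<close>] .
  moreover have "FFTP G ?Z" by (rule FFTP_ball[OF gen FFTP]) (simp add: m_def)
  ultimately show "\<exists>X'. Y \<subseteq> X' \<and> finite X' \<and> generating_set G X' \<and> FFTP G X'"
    by blast
qed

end

theorem proposition3p2:
  fixes G :: "('a, 'b) monoid_scheme" and X :: "'a set"
  assumes "group G"
    and "finite X"
    and "generating_set G X"
    and "FFTP G X"
  shows "(\<forall>m::nat. m > 0 \<longrightarrow> FFTP G {g \<in> carrier G. word_length G X g \<le> m}) \<and> FFTP_completable G"
  using group.FFTP_ball[OF assms(1,3,4)] group.FFTP_completable_of_FFTP[OF assms(1,3,2,4)]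
  by blast

end
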